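(* $(2^{\omega_1})_\delta\to(\mathbf{\Sigma})^1_2$; that is, whenever $(2^{\omega_1})_\delta=A\cup B$, the space $\mathbf{\Sigma}$ is homeomorphic to a subspace of $A$ or to a subspace of $B$.
   Context: For a $T_1$-space $X$, the $G_\delta$-modification $(X)_\delta$ is the set $X$ endowed with the topology generated by all $G_\delta$-subsets of $X$. $2^{\omega_1}=\{0,1\}^{\omega_1}$ carries the product topology ($\{0,1\}$ discrete), and $(2^{\omega_1})_\delta$ is its $G_\delta$-modification; a base consists of the sets $[f]=\{g\in 2^{\omega_1}: f\subseteq g\}$ with $f\in 2^\alpha$, $\alpha<\omega_1$. $\mathbf{\Sigma}$ is the subspace of $(2^{\omega_1})_\delta$ consisting of all $g\in 2^{\omega_1}$ for which there is $\alpha<\omega_1$ with $g(\gamma)=0$ for all $\alpha\le\gamma<\omega_1$. The notation $X\to(Y)^1_2$ means that $Y$ can be embedded (as a topological subspace) into one of $A$ or $B$ for any subspaces $A,B$ with $X=A\cup B$. *)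

theory Defs
  imports "HOL-Analysis.Analysis" "HOL-Library.Countable_Set_Type"
begin

text \<open>The ordinal \<open>\<omega>\<^sub>1\<close> as a well-ordered type: \<open>cardSuc natLeq\<close> is the cardinal successor of
  \<open>\<aleph>\<^sub>0\<close>, represented as a well-order. The lemmas below the instance confirm that the type is
  uncountable and that its proper initial segments are countable, which determines the order type.\<close>

typedef omega1 = "Field (cardSuc natLeq)"
proof -
  have "Field (cardSuc natLeq) \<noteq> {}"
    by (intro Cnotzero_imp_not_empty Cinfinite_Cnotzero Cinfinite_cardSuc natLeq_Cinfinite)
  then show ?thesis by blast
qed

lemma cardSuc_natLeq_Well_order: "Well_order (cardSuc natLeq)"
  using cardSuc_Card_order[OF natLeq_Card_order] card_order_on_well_order_on by blast

instantiation omega1 :: wellorder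
begin

definition less_eq_omega1 :: "omega1 \<Rightarrow> omega1 \<Rightarrow> bool" where
  "\<alpha> \<le> \<beta> \<longleftrightarrow> (Rep_omega1 \<alpha>, Rep_omega1 \<beta>) \<in> cardSuc natLeq"

definition less_omega1 :: "omega1 \<Rightarrow> omega1 \<Rightarrow> bool" where
  "\<alpha> < \<beta> \<longleftrightarrow> \<alpha> \<le> \<beta> \<and> \<alpha> \<noteq> (\<beta> :: omega1)"

instance
proof
  let ?r = "cardSuc natLeq"
  note wo = cardSuc_natLeq_Well_order
  have lin: "refl_on (Field ?r) ?r" "trans ?r" "antisym ?r" "total_on (Field ?r) ?r"
    and wf: "wf (?r - Id)"
    using wo by (auto simp: well_order_on_def linear_order_on_def partial_order_on_def
        preorder_on_def)
  fix x y z :: omega1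
  show refl: "x \<le> x"
    using lin(1) Rep_omega1[of x] by (auto simp: less_eq_omega1_def refl_on_def)
  show "x \<le> y \<Longrightarrow> y \<le> z \<Longrightarrow> x \<le> z"
    using lin(2) unfolding less_eq_omega1_def trans_def by blast
  show anti: "x \<le> y \<Longrightarrow> y \<le> x \<Longrightarrow> x = y"
    using lin(3) unfolding less_eq_omega1_def antisym_def
    by (metis Rep_omega1_inject)
  show "(x < y) = (x \<le> y \<and> \<not> y \<le> x)"
    using anti refl by (auto simp: less_omega1_def)
  show "x \<le> y \<or> y \<le> x"
    using lin(4) refl Rep_omega1[of x] Rep_omega1[of y]
    by (cases "x = y") (auto simp: less_eq_omega1_def total_on_def Rep_omega1_inject)
  fix P :: "omega1 \<Rightarrow> bool" and a
  assume step: "\<And>x. (\<And>y. y < x \<Longrightarrow> P y) \<Longrightarrow> P x"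
  have "wf {(x, y). x < (y :: omega1)}"
    by (rule wf_subset[OF wf_inv_image[OF wf, of Rep_omega1]])
      (auto simp: less_omega1_def less_eq_omega1_def inv_image_def Rep_omega1_inject)
  then show "P a"
    using step by (induction a rule: wf_induct_rule) auto
qed

end

lemma uncountable_omega1:
  includes cardinal_syntax
  shows "uncountable (UNIV :: omega1 set)"
proof
  assume "countable (UNIV :: omega1 set)"
  then have "countable (Field (cardSuc natLeq))"
    by (metis countable_image type_definition.Rep_range[OF type_definition_omega1])
  then have "|Field (cardSuc natLeq)| \<le>o natLeq"
    by (simp add: countable_card_le_natLeq)
  moreover have "cardSuc natLeq =o |Field (cardSuc natLeq)|"
    using card_of_Field_ordIso[OF cardSuc_Card_order[OF natLeq_Card_order]] ordIso_symmetric
    by blast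
  ultimately have "cardSuc natLeq \<le>o natLeq"
    using ordIso_ordLeq_trans by blast
  then show False
    using cardSuc_greater[OF natLeq_Card_order] not_ordLess_ordLeq by blast
qed

lemma countable_lessThan_omega1:
  includes cardinal_syntax
  shows "countable {..<\<alpha> :: omega1}"
proof -
  let ?r = "cardSuc natLeq" and ?U = "underS (cardSuc natLeq) (Rep_omega1 \<alpha>)"
  have "|?U| <o ?r"
    by (rule card_of_underS[OF cardSuc_Card_order[OF natLeq_Card_order] Rep_omega1])
  then have "|?U| \<le>o natLeq"
    using cardSuc_ordLeq_ordLess[OF natLeq_Card_order card_of_Card_order] by blast
  then have "countable ?U"
    by (simp add: countable_card_le_natLeq)
  moreover have "Rep_omega1 ` {..<\<alpha>} \<subseteq> ?U"
    by (auto simp: underS_def less_omega1_def less_eq_omega1_def Rep_omega1_inject)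
  ultimately have "countable (Rep_omega1 ` {..<\<alpha>})"
    using countable_subset by blast
  then show ?thesis
    by (rule countable_image_inj_on) (simp add: inj_on_def Rep_omega1_inject)
qed

definition G_delta_modification :: "'a topology \<Rightarrow> 'a topology" where
  "G_delta_modification X = topology_generated_by {S. gdelta_in X S}"

text \<open>The set \<open>{0,1}\<close> is rendered as \<^typ>\<open>bool\<close>, with \<^term>\<open>False\<close> in the role of \<open>0\<close>.\<close>

definition cantor_omega1 :: "(omega1 \<Rightarrow> bool) topology" where
  "cantor_omega1 = product_topology (\<lambda>_. discrete_topology UNIV) UNIV"

definition Sigma_space :: "(omega1 \<Rightarrow> bool) topology" where
  "Sigma_space = subtopology (G_delta_modification cantor_omega1)
     {g. \<exists>\<alpha>. \<forall>\<gamma>\<ge>\<alpha>. g \<gamma> = False}"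

text \<open>The relation \<open>X \<rightarrow> (Y)\<^sup>1\<^sub>2\<close>; the pieces \<open>A\<close> and \<open>B\<close> need not be disjoint.\<close>

definition arrow_1_2 :: "'a topology \<Rightarrow> 'b topology \<Rightarrow> bool" where
  "arrow_1_2 X Y \<longleftrightarrow> (\<forall>A B. topspace X = A \<union> B \<longrightarrow>
     (\<exists>f. embedding_map Y (subtopology X A) f) \<or> (\<exists>f. embedding_map Y (subtopology X B) f))"

end

theory Submission
  imports Defs
begin

text \<open>Call a set dense if it meets every basic open set \<open>[f]\<close>. If \<open>A\<close> is not dense, then \<open>B\<close>
  contains some \<open>[f]\<close>, which contains a copy of the whole space. If \<open>A\<close> is dense, define \<open>F g\<close>
  by recursion: along a maximal block of zeros of \<open>g\<close> starting at \<open>\<mu>\<close>, let \<open>F g\<close> follow a point of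
  \<open>A\<close> that was chosen as a function of \<open>F g\<close> restricted to \<open>\<mu>\<close>, and leave that point wherever \<open>g\<close>
  takes the value one. Then \<open>F\<close> preserves the length of the longest common initial segment, and on
  \<open>\<Sigma>\<close>, where the last block of zeros is unbounded, its values are chosen points of \<open>A\<close>.\<close>

section \<open>Countable subsets of the first uncountable ordinal\<close>

text \<open>A countable union of countable initial segments is not the whole of the uncountable
  type, and a point left out lies above all of \<open>C\<close>. Every later choice of a cylinder
  length that must exceed countably many ordinals rests on this.\<close>

lemma countable_omega1_bounded:
  fixes C :: "omega1 set"
  assumes "countable C"
  shows "\<exists>\<alpha>. \<forall>\<gamma>\<in>C. \<gamma> < \<alpha>"
proof -
  have "{..\<gamma>} = insert \<gamma> {..<\<gamma>}" for \<gamma> :: omega1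
    by auto
  then have "countable (\<Union>\<gamma>\<in>C. {..\<gamma>})"
    using assms countable_lessThan_omega1 by (simp add: countable_UN)
  then have "(\<Union>\<gamma>\<in>C. {..\<gamma>}) \<noteq> UNIV"
    using uncountable_omega1 by metis
  then obtain \<alpha> where "\<alpha> \<notin> (\<Union>\<gamma>\<in>C. {..\<gamma>})"
    by blast
  then show ?thesis
    by (auto simp: not_le)
qed

text \<open>Recursion picks each value strictly above \<mu> and all earlier values, which are
  countably many. The map serves to move all coordinates beyond \<mu>.\<close>

lemma exists_inj_omega1_ge:
  obtains k :: "omega1 \<Rightarrow> omega1" where "inj k" "\<And>\<gamma>. \<mu> \<le> k \<gamma>"
proof -
  let ?P = "\<lambda>k \<beta> x. \<mu> \<le> x \<and> (\<forall>\<alpha><\<beta>. k \<alpha> < x)"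
  define k where "k = wfrec {(\<alpha>, \<beta> :: omega1). \<alpha> < \<beta>} (\<lambda>k \<beta>. SOME x. ?P k \<beta> x)"
  have k_eq: "k \<beta> = (SOME x. ?P k \<beta> x)" for \<beta>
    unfolding k_def by (subst wfrec[OF wf]) (simp add: cut_def cong: conj_cong imp_cong)
  have "\<exists>x. ?P k \<beta> x" for \<beta>
  proof -
    have "countable (insert \<mu> (k ` {..<\<beta>}))"
      by (simp add: countable_lessThan_omega1)
    then obtain x where "\<forall>\<gamma>\<in>insert \<mu> (k ` {..<\<beta>}). \<gamma> < x"
      using countable_omega1_bounded by blast
    then have "?P k \<beta> x"
      by (simp add: less_imp_le)
    then show ?thesis ..
  qed
  from someI_ex[OF this] have k: "?P k \<beta> (k \<beta>)" for \<beta>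
    unfolding k_eq[symmetric] .
  then have "strict_mono k"
    by (simp add: strict_monoI)
  then show ?thesis
    using that[of k] k strict_mono_imp_inj_on by blast
qed

section \<open>Cylinders as a base of the G_delta-modification\<close>

text \<open>This is the basic set \<open>[f]\<close> for \<open>f\<close> the restriction of
  \<open>g\<close> to \<alpha>; a total function together with a length replaces a function on an
  initial segment.\<close>

definition cylinder :: "(omega1 \<Rightarrow> bool) \<Rightarrow> omega1 \<Rightarrow> (omega1 \<Rightarrow> bool) set" where
  "cylinder g \<alpha> = {h. \<forall>\<gamma><\<alpha>. h \<gamma> = g \<gamma>}"

lemma mem_cylinder_self: "g \<in> cylinder g \<alpha>"
  by (simp add: cylinder_def)

lemma cylinder_antimono: "\<alpha> \<le> \<beta> \<Longrightarrow> cylinder g \<beta> \<subseteq> cylinder g \<alpha>"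
  by (auto simp: cylinder_def)

lemma cylinder_eq: "h \<in> cylinder g \<alpha> \<Longrightarrow> cylinder h \<alpha> = cylinder g \<alpha>"
  by (auto simp: cylinder_def)

lemma topspace_cantor_omega1 [simp]: "topspace cantor_omega1 = UNIV"
  by (simp add: cantor_omega1_def)

text \<open>A basic open set of the product restricts finitely many coordinates, and these are
  bounded.\<close>

lemma openin_cantor_omega1_cylinder:
  assumes "openin cantor_omega1 U" "g \<in> U"
  obtains \<alpha> where "cylinder g \<alpha> \<subseteq> U"
proof -
  obtain V where V: "finite {i. V i \<noteq> UNIV}" "g \<in> Pi\<^sub>E UNIV V" "Pi\<^sub>E UNIV V \<subseteq> U"
    using assms unfolding cantor_omega1_def openin_product_topology_alt by auto
  obtain \<alpha> where "\<forall>\<gamma>. V \<gamma> \<noteq> UNIV \<longrightarrow> \<gamma> < \<alpha>"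
    using countable_omega1_bounded[OF countable_finite[OF V(1)]] by auto
  then have "cylinder g \<alpha> \<subseteq> Pi\<^sub>E UNIV V"
    using V(2) by (fastforce simp: cylinder_def PiE_UNIV_domain)
  then show ?thesis
    using V(3) by (intro that) (rule order_trans)
qed

text \<open>Each of the countably many open sets contains a cylinder around \<open>g\<close>; a
  bound of their lengths works for all of them at once.\<close>

lemma gdelta_in_cantor_omega1_cylinder:
  assumes "gdelta_in cantor_omega1 S" "g \<in> S"
  obtains \<alpha> where "cylinder g \<alpha> \<subseteq> S"
proof -
  obtain \<U> where \<U>: "countable \<U>" "\<And>U. U \<in> \<U> \<Longrightarrow> openin cantor_omega1 U" "S = \<Inter>\<U>"
    using assms(1) by (auto simp: gdelta_in_alt intersection_of_def)
  have "\<exists>\<alpha>. cylinder g \<alpha> \<subseteq> U" if "U \<in> \<U>" for U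
    using openin_cantor_omega1_cylinder[OF \<U>(2)[OF that]] assms(2) \<U>(3) that by blast
  then obtain a where a: "\<And>U. U \<in> \<U> \<Longrightarrow> cylinder g (a U) \<subseteq> U"
    by metis
  have "countable (a ` \<U>)"
    using \<U>(1) by simp
  then obtain \<alpha> where "\<forall>\<gamma>\<in>a ` \<U>. \<gamma> < \<alpha>"
    using countable_omega1_bounded by blast
  then have "cylinder g \<alpha> \<subseteq> U" if "U \<in> \<U>" for U
    using a[OF that] cylinder_antimono[of "a U" \<alpha> g] that by (meson imageI less_imp_le order_trans)
  then show ?thesis
    using that \<U>(3) by blast
qed

lemma gdelta_in_cylinder: "gdelta_in cantor_omega1 (cylinder g \<alpha>)"
proof -
  let ?\<U> = "insert UNIV ((\<lambda>\<gamma>. {h. h \<gamma> = g \<gamma>}) ` {..<\<alpha>})"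
  have "openin cantor_omega1 {h \<in> topspace cantor_omega1. h \<gamma> \<in> {g \<gamma>}}" for \<gamma>
    unfolding cantor_omega1_def
    by (rule openin_continuous_map_preimage[OF continuous_map_product_projection]) auto
  moreover have "openin cantor_omega1 UNIV"
    using openin_topspace[of cantor_omega1] by simp
  ultimately have "\<forall>U\<in>?\<U>. openin cantor_omega1 U"
    by auto
  moreover have "countable ?\<U>"
    by (simp add: countable_lessThan_omega1)
  moreover have "cylinder g \<alpha> = \<Inter>?\<U>"
    by (auto simp: cylinder_def)
  ultimately show ?thesis
    unfolding gdelta_in_alt intersection_of_def by (auto intro!: exI[of _ ?\<U>])
qed

abbreviation cantor_delta :: "(omega1 \<Rightarrow> bool) topology" where
  "cantor_delta \<equiv> G_delta_modification cantor_omega1"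

lemma openin_cantor_delta_iff:
  "openin cantor_delta U \<longleftrightarrow> (\<forall>g\<in>U. \<exists>\<alpha>. cylinder g \<alpha> \<subseteq> U)"
proof
  assume "openin cantor_delta U"
  then have "generate_topology_on {S. gdelta_in cantor_omega1 S} U"
    by (simp add: G_delta_modification_def openin_topology_generated_by)
  then show "\<forall>g\<in>U. \<exists>\<alpha>. cylinder g \<alpha> \<subseteq> U"
  proof induction
    case (Int a b)
    show ?case
    proof
      fix g assume "g \<in> a \<inter> b"
      then obtain \<alpha> \<beta> where "cylinder g \<alpha> \<subseteq> a" "cylinder g \<beta> \<subseteq> b"
        using Int.IH by blast
      then have "cylinder g (max \<alpha> \<beta>) \<subseteq> a \<inter> b"
        using cylinder_antimono[of \<alpha> "max \<alpha> \<beta>" g] cylinder_antimono[of \<beta> "max \<alpha> \<beta>" g] by auto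
      then show "\<exists>\<alpha>. cylinder g \<alpha> \<subseteq> a \<inter> b" ..
    qed
  next
    case (UN K)
    then show ?case
      by (meson Union_iff Union_upper order_trans)
  next
    case (Basis s)
    then show ?case
      using gdelta_in_cantor_omega1_cylinder by (metis mem_Collect_eq)
  qed simp
next
  assume U: "\<forall>g\<in>U. \<exists>\<alpha>. cylinder g \<alpha> \<subseteq> U"
  \<comment> \<open>Cylinders are themselves G_delta sets, hence open, so the open subsets of
    \<open>U\<close> already cover it.\<close>
  have "U = \<Union>{V. openin cantor_delta V \<and> V \<subseteq> U}" (is "_ = \<Union>?\<V>")
  proof
    show "U \<subseteq> \<Union>?\<V>"
    proof
      fix g assume "g \<in> U"
      then obtain \<alpha> where "cylinder g \<alpha> \<subseteq> U"
        using U by blast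
      moreover have "openin cantor_delta (cylinder g \<alpha>)"
        unfolding G_delta_modification_def
        by (rule topology_generated_by_Basis) (simp add: gdelta_in_cylinder)
      ultimately show "g \<in> \<Union>?\<V>"
        using mem_cylinder_self[of g \<alpha>] by blast
    qed
  qed blast
  moreover have "openin cantor_delta (\<Union>?\<V>)"
    by (rule openin_Union) simp
  ultimately show "openin cantor_delta U"
    by (rule ssubst)
qed

lemma topspace_cantor_delta [simp]: "topspace cantor_delta = UNIV"
proof -
  have "openin cantor_delta UNIV"
    by (simp add: openin_cantor_delta_iff)
  from openin_subset[OF this] show ?thesis
    by blast
qed

section \<open>A criterion for embeddings\<close>

text \<open>\<open>cont\<close> is continuity and \<open>inv\<close> is continuity of the inverse,
  both in terms of cylinders. \<open>inv\<close> also yields injectivity: if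
  \<open>F g = F h\<close>, then \<open>g\<close> lies in every cylinder around \<open>h\<close>.
  Both concern the whole space; only \<open>img\<close> depends on \<open>S\<close>.\<close>

lemma embedding_map_cantor_delta:
  fixes F :: "(omega1 \<Rightarrow> bool) \<Rightarrow> omega1 \<Rightarrow> bool"
  assumes cont: "\<And>g \<alpha>. \<exists>\<beta>. \<forall>h \<in> cylinder g \<beta>. F h \<in> cylinder (F g) \<alpha>"
    and inv: "\<And>g \<alpha>. \<exists>\<beta>. \<forall>h. F h \<in> cylinder (F g) \<beta> \<longrightarrow> h \<in> cylinder g \<alpha>"
    and img: "F ` S \<subseteq> A"
  shows "embedding_map (subtopology cantor_delta S) (subtopology cantor_delta A) F"
proof -
  have inj: "inj F"
  proof (rule injI, rule ext)
    fix g h and \<gamma> :: omega1 assume "F g = F h"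
    obtain \<alpha> where "\<gamma> < \<alpha>"
      using countable_omega1_bounded[of "{\<gamma>}"] by auto
    moreover have "g \<in> cylinder h \<alpha>"
      using inv[of h \<alpha>] \<open>F g = F h\<close> mem_cylinder_self by metis
    ultimately show "g \<gamma> = h \<gamma>"
      by (simp add: cylinder_def)
  qed
  have "continuous_map cantor_delta cantor_delta F"
    unfolding continuous_map_def
  proof (intro conjI allI impI)
    fix U assume U: "openin cantor_delta U"
    have "\<exists>\<beta>. cylinder g \<beta> \<subseteq> {x. F x \<in> U}" if g: "F g \<in> U" for g
    proof -
      obtain \<alpha> where "cylinder (F g) \<alpha> \<subseteq> U"
        using U g unfolding openin_cantor_delta_iff by blast
      then show ?thesis
        using cont[of g \<alpha>] by blast
    qed
    then show "openin cantor_delta {x \<in> topspace cantor_delta. F x \<in> U}"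
      by (simp add: openin_cantor_delta_iff)
  qed simp
  then have "continuous_map (subtopology cantor_delta S) (subtopology cantor_delta (F ` S)) F"
    by (simp add: continuous_map_from_subtopology continuous_map_in_subtopology)
  moreover have "open_map (subtopology cantor_delta S) (subtopology cantor_delta (F ` S)) F"
    unfolding open_map_def
  proof (intro allI impI)
    fix W assume "openin (subtopology cantor_delta S) W"
    then obtain U where U: "openin cantor_delta U" "W = U \<inter> S"
      by (auto simp: openin_subtopology)
    define V where "V = {x. \<exists>g\<in>U. \<exists>\<beta>. x \<in> cylinder (F g) \<beta> \<and> (\<forall>h. F h \<in> cylinder (F g) \<beta> \<longrightarrow> h \<in> U)}"
    have "openin cantor_delta V"
      unfolding openin_cantor_delta_iff V_def using cylinder_eq by blast
    moreover have "F ` W = V \<inter> F ` S"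
    proof
      show "F ` W \<subseteq> V \<inter> F ` S"
      proof
        fix x assume "x \<in> F ` W"
        then obtain g where g: "x = F g" "g \<in> U" "g \<in> S"
          using U(2) by auto
        obtain \<alpha> where "cylinder g \<alpha> \<subseteq> U"
          using U(1) g(2) unfolding openin_cantor_delta_iff by blast
        then obtain \<beta> where "\<forall>h. F h \<in> cylinder (F g) \<beta> \<longrightarrow> h \<in> U"
          using inv[of g \<alpha>] by blast
        then show "x \<in> V \<inter> F ` S"
          unfolding V_def using g mem_cylinder_self by blast
      qed
      show "V \<inter> F ` S \<subseteq> F ` W"
        using U(2) unfolding V_def by auto
    qed
    ultimately show "openin (subtopology cantor_delta (F ` S)) (F ` W)"
      by (auto simp: openin_subtopology)
  qed
  ultimately have "homeomorphic_map (subtopology cantor_delta S) (subtopology cantor_delta (F ` S)) F"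
    by (intro bijective_open_imp_homeomorphic_map) (auto intro: inj_on_subset[OF inj])
  moreover have "A \<inter> F ` S = F ` S"
    using img by blast
  ultimately show ?thesis
    by (simp add: embedding_map_def subtopology_subtopology)
qed

section \<open>The case of a piece that contains a cylinder\<close>

text \<open>Below \<mu> the image follows \<open>f\<close>; a copy of \<open>g\<close> is written on
  the coordinates in the range of \<open>k\<close>, all of which are at least \<mu>.\<close>

lemma embedding_map_into_cylinder:
  assumes "cylinder f \<mu> \<subseteq> B"
  shows "\<exists>F. embedding_map (subtopology cantor_delta S) (subtopology cantor_delta B) F"
proof -
  obtain k :: "omega1 \<Rightarrow> omega1" where k: "inj k" "\<And>\<gamma>. \<mu> \<le> k \<gamma>"
    using exists_inj_omega1_ge by blast
  define F :: "(omega1 \<Rightarrow> bool) \<Rightarrow> omega1 \<Rightarrow> bool"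
    where "F g \<gamma> = (if \<gamma> \<in> range k then g (inv k \<gamma>) else f \<gamma>)" for g \<gamma>
  have Fk: "F g (k \<gamma>) = g \<gamma>" for g \<gamma>
    using k(1) by (simp add: F_def)
  have "\<gamma> \<notin> range k" if "\<gamma> < \<mu>" for \<gamma>
    using k(2) that by (auto simp: leD)
  then have "F ` S \<subseteq> cylinder f \<mu>"
    by (auto simp: cylinder_def F_def)
  moreover have "\<exists>\<beta>. \<forall>h \<in> cylinder g \<beta>. F h \<in> cylinder (F g) \<alpha>" for g \<alpha>
  proof -
    \<comment> \<open>Below \<alpha>, \<open>F g\<close> reads \<open>g\<close> only at coordinates
      in this set.\<close>
    have "countable (inv k ` {..<\<alpha>})"
      by (simp add: countable_lessThan_omega1)
    then obtain \<beta> where "\<forall>\<gamma>\<in>inv k ` {..<\<alpha>}. \<gamma> < \<beta>"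
      using countable_omega1_bounded by blast
    then have "\<forall>h \<in> cylinder g \<beta>. F h \<in> cylinder (F g) \<alpha>"
      by (simp add: cylinder_def F_def)
    then show ?thesis ..
  qed
  moreover have "\<exists>\<beta>. \<forall>h. F h \<in> cylinder (F g) \<beta> \<longrightarrow> h \<in> cylinder g \<alpha>" for g \<alpha>
  proof -
    \<comment> \<open>Conversely, these coordinates of \<open>F g\<close> carry the values of
      \<open>g\<close> below \<alpha>.\<close>
    have "countable (k ` {..<\<alpha>})"
      by (simp add: countable_lessThan_omega1)
    then obtain \<beta> where "\<forall>\<gamma>\<in>k ` {..<\<alpha>}. \<gamma> < \<beta>"
      using countable_omega1_bounded by blast
    then have "F h (k \<gamma>) = F g (k \<gamma>)" if "F h \<in> cylinder (F g) \<beta>" "\<gamma> < \<alpha>" for h \<gamma>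
      using that by (simp add: cylinder_def)
    then have "\<forall>h. F h \<in> cylinder (F g) \<beta> \<longrightarrow> h \<in> cylinder g \<alpha>"
      by (simp add: Fk cylinder_def[of g])
    then show ?thesis ..
  qed
  ultimately show ?thesis
    using assms embedding_map_cantor_delta[of F S B] by blast
qed

section \<open>The case of a dense piece\<close>

text \<open>The value is \<alpha> itself when no nonempty block of zeros ends just below \<alpha>.
  The value \<open>g \<alpha>\<close> is left out, so the recursion can find its block before
  reading it.\<close>

definition zero_block_start :: "(omega1 \<Rightarrow> bool) \<Rightarrow> omega1 \<Rightarrow> omega1" where
  "zero_block_start g \<alpha> = (LEAST \<mu>. \<forall>\<gamma>. \<mu> \<le> \<gamma> \<longrightarrow> \<gamma> < \<alpha> \<longrightarrow> \<not> g \<gamma>)"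

lemma zero_block_start_le: "zero_block_start g \<alpha> \<le> \<alpha>"
  unfolding zero_block_start_def by (rule Least_le) (simp add: leD)

lemma zero_block_start_cong:
  assumes "h \<in> cylinder g \<alpha>"
  shows "zero_block_start h \<alpha> = zero_block_start g \<alpha>"
proof -
  have "(\<forall>\<gamma>. \<mu> \<le> \<gamma> \<longrightarrow> \<gamma> < \<alpha> \<longrightarrow> \<not> h \<gamma>) \<longleftrightarrow> (\<forall>\<gamma>. \<mu> \<le> \<gamma> \<longrightarrow> \<gamma> < \<alpha> \<longrightarrow> \<not> g \<gamma>)" for \<mu>
    using assms unfolding cylinder_def by blast
  then show ?thesis
    by (simp only: zero_block_start_def)
qed

text \<open>Take the least \<mu> from which on \<open>g\<close> vanishes. For \<beta> beyond it,
  vanishing on the interval from \<nu> to \<beta> is the same as vanishing from \<nu> on, so the two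
  least elements coincide.\<close>

lemma zero_block_start_eventually_zero:
  fixes g :: "omega1 \<Rightarrow> bool"
  assumes "\<forall>\<gamma>\<ge>\<alpha>. \<not> g \<gamma>"
  obtains \<mu> where "\<And>\<beta>. \<mu> \<le> \<beta> \<Longrightarrow> \<not> g \<beta> \<and> zero_block_start g \<beta> = \<mu>"
proof
  define \<mu> where "\<mu> = (LEAST \<mu>. \<forall>\<gamma>\<ge>\<mu>. \<not> g \<gamma>)"
  have \<mu>: "\<forall>\<gamma>\<ge>\<mu>. \<not> g \<gamma>"
    unfolding \<mu>_def using assms by (rule LeastI)
  fix \<beta> assume "\<mu> \<le> \<beta>"
  then have "(\<forall>\<gamma>. \<nu> \<le> \<gamma> \<longrightarrow> \<gamma> < \<beta> \<longrightarrow> \<not> g \<gamma>) \<longleftrightarrow> (\<forall>\<gamma>\<ge>\<nu>. \<not> g \<gamma>)" for \<nu>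
    using \<mu> by (meson not_le order_trans)
  then show "\<not> g \<beta> \<and> zero_block_start g \<beta> = \<mu>"
    using \<mu> \<open>\<mu> \<le> \<beta>\<close> by (simp add: zero_block_start_def \<mu>_def)
qed

lemma embedding_map_Sigma_space_dense:
  assumes dense: "\<And>f \<mu>. A \<inter> cylinder f \<mu> \<noteq> {}"
  shows "\<exists>F. embedding_map Sigma_space (subtopology cantor_delta A) F"
proof -
  \<comment> \<open>The choice refers to \<open>f\<close> only through its cylinder, so functions
    that agree below \<mu> get the same point.\<close>
  define c where "c f \<mu> = (SOME x. x \<in> A \<inter> cylinder f \<mu>)" for f \<mu>
  have c: "c f \<mu> \<in> A" "c f \<mu> \<in> cylinder f \<mu>" for f \<mu>
    unfolding c_def using some_in_eq[of "A \<inter> cylinder f \<mu>"] dense by auto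
  have c_cong: "c h \<mu> = c f \<mu>" if "h \<in> cylinder f \<mu>" for h f \<mu>
    using cylinder_eq[OF that] by (simp add: c_def)
  \<comment> \<open>The inequality of truth values is an exclusive or: a zero of \<open>g\<close>
    copies the chosen point at \<alpha>, a one flips it.\<close>
  define F where "F g = wfrec {(\<alpha>, \<beta> :: omega1). \<alpha> < \<beta>}
      (\<lambda>p \<alpha>. g \<alpha> \<noteq> c p (zero_block_start g \<alpha>) \<alpha>)" for g
  have F: "F g \<alpha> \<longleftrightarrow> g \<alpha> \<noteq> c (F g) (zero_block_start g \<alpha>) \<alpha>" for g \<alpha>
  proof -
    \<comment> \<open>\<open>cut\<close> alters \<open>F g\<close> only from \<alpha> on, and the
      block starts no later than \<alpha>, so the chosen point is unchanged.\<close>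
    have "cut (F g) {(\<alpha>, \<beta>). \<alpha> < \<beta>} \<alpha> \<in> cylinder (F g) (zero_block_start g \<alpha>)"
      using zero_block_start_le[of g \<alpha>] by (auto simp: cylinder_def cut_def)
    from c_cong[OF this] show ?thesis
      unfolding F_def by (subst wfrec[OF wf]) simp
  qed
  \<comment> \<open>Agreement below \<alpha> gives both functions the same block start and the same
    chosen point.\<close>
  have step: "F h \<alpha> = F g \<alpha> \<longleftrightarrow> h \<alpha> = g \<alpha>" if "h \<in> cylinder g \<alpha>" "F h \<in> cylinder (F g) \<alpha>" for g h \<alpha>
  proof -
    have "F h \<in> cylinder (F g) (zero_block_start g \<alpha>)"
      using that(2) cylinder_antimono zero_block_start_le by blast
    then show ?thesis
      using F[of h \<alpha>] F[of g \<alpha>] zero_block_start_cong[OF that(1)] c_cong by auto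
  qed
  \<comment> \<open>This gives both \<open>cont\<close> and \<open>inv\<close> with \<beta> =
    \<alpha>. In the induction, either agreement below \<beta> restricts to each \<gamma> < \<beta>,
    the hypothesis supplies the other one, and \<open>step\<close> applies at \<gamma>.\<close>
  have "F h \<in> cylinder (F g) \<alpha> \<longleftrightarrow> h \<in> cylinder g \<alpha>" for g h \<alpha>
  proof -
    have "(F h \<in> cylinder (F g) \<alpha> \<longrightarrow> h \<in> cylinder g \<alpha>)
        \<and> (h \<in> cylinder g \<alpha> \<longrightarrow> F h \<in> cylinder (F g) \<alpha>)"
    proof (induction \<alpha> rule: less_induct)
      case (less \<beta>)
      have restr: "x \<in> cylinder y \<gamma>" if "x \<in> cylinder y \<beta>" "\<gamma> < \<beta>" for x y \<gamma>
        using cylinder_antimono[OF less_imp_le[OF that(2)]] that(1) by blast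
      have "F h \<gamma> = F g \<gamma> \<longleftrightarrow> h \<gamma> = g \<gamma>"
        if "\<gamma> < \<beta>" "F h \<in> cylinder (F g) \<beta> \<or> h \<in> cylinder g \<beta>" for \<gamma>
        using step[of h g \<gamma>] less[OF that(1)] restr[OF _ that(1)] that(2) by blast
      then show ?case
        unfolding cylinder_def mem_Collect_eq by blast
    qed
    then show ?thesis
      by blast
  qed
  moreover have "F g \<in> A" if zero: "\<forall>\<gamma>\<ge>\<alpha>. \<not> g \<gamma>" for g \<alpha>
  proof -
    obtain \<mu> where \<mu>: "\<And>\<beta>. \<mu> \<le> \<beta> \<Longrightarrow> \<not> g \<beta> \<and> zero_block_start g \<beta> = \<mu>"
      using zero_block_start_eventually_zero[OF zero] by blast
    \<comment> \<open>Below \<mu> the chosen point extends \<open>F g\<close> by its choice; from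
      \<mu> on \<open>g\<close> is zero and \<open>F g\<close> copies that point.\<close>
    have "F g \<beta> = c (F g) \<mu> \<beta>" for \<beta>
    proof (cases "\<beta> < \<mu>")
      case True
      then show ?thesis
        using c(2)[of "F g" \<mu>] by (simp add: cylinder_def)
    next
      case False
      then show ?thesis
        using F[of g \<beta>] \<mu>[of \<beta>] False by simp
    qed
    then have "F g = c (F g) \<mu>"
      by blast
    then show ?thesis
      using c(1) by metis
  qed
  ultimately have "embedding_map Sigma_space (subtopology cantor_delta A) F"
    unfolding Sigma_space_def by (intro embedding_map_cantor_delta) auto
  then show ?thesis
    by blast
qed

section \<open>Combining the two cases\<close>

theorem mainTheorem2:
  shows "arrow_1_2 (G_delta_modification cantor_omega1) Sigma_space"
  unfolding arrow_1_2_def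
proof (intro allI impI)
  fix A B :: "(omega1 \<Rightarrow> bool) set"
  assume AB: "topspace cantor_delta = A \<union> B"
  show "(\<exists>f. embedding_map Sigma_space (subtopology cantor_delta A) f) \<or>
    (\<exists>f. embedding_map Sigma_space (subtopology cantor_delta B) f)"
  proof (cases "\<forall>f \<mu>. A \<inter> cylinder f \<mu> \<noteq> {}")
    case True
    then show ?thesis
      using embedding_map_Sigma_space_dense by blast
  next
    case False
    then obtain f \<mu> where "cylinder f \<mu> \<subseteq> B"
      using AB by auto
    then show ?thesis
      unfolding Sigma_space_def using embedding_map_into_cylinder by blast
  qed
qed

end
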